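(* Let $d\ge1$, $p\in[0,1]$, and let $S$ be a multi-dimensional elephant random walk on $\mathbb{Z}^d$ with parameter $p$. Let $A_1$ be the event that every vertex of $\mathbb{Z}^d$ is visited by $S$ infinitely often, and let $A_2$ be the event that every vertex of $\mathbb{Z}^d$ is visited by $S$ finitely often. Then $\mathbb{P}(A_1\cup A_2)=1$.
   Context: Multi-dimensional elephant random walk (MERW): let $e_1,\dots,e_d$ be the standard basis of $\mathbb{R}^d$ and $p\in[0,1]$. Set $S_0=0$ and $S_1=\sigma_1=e_1$. For each $n\ge 1$, choose $n'$ uniformly at random in $\{1,\dots,n\}$ (independently of the past); given the past and $n'$, let $\sigma_{n+1}=\sigma_{n'}$ with probability $p$, and $\sigma_{n+1}=\sigma$ with probability $\frac{1-p}{2d-1}$ for each $\sigma\in\{\pm e_1,\dots,\pm e_d\}\setminus\{\sigma_{n'}\}$. Set $S_{n+1}=S_n+\sigma_{n+1}$. *)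

theory Defs
  imports "HOL-Probability.Probability"
begin

definition unit_steps :: "(int ^ 'd::finite) set" where
  "unit_steps = (\<Union>i. {axis i 1, - axis i 1})"

text \<open>
  The lattice is \<^typ>\<open>int ^ 'd\<close> with \<open>d = CARD('d)\<close>. Since the index type carries no
  order, the coordinate called 1 is the parameter \<open>\<iota>\<close>, so that \<open>axis \<iota> 1\<close> is the vector \<open>e\<^sub>1\<close>.
  The variable \<open>\<nu> n\<close> is the index \<open>n'\<close> drawn from \<open>{1..n}\<close> to produce step \<open>n + 1\<close>; hence
  \<open>\<sigma> 1, \<dots>, \<sigma> n\<close> and \<open>\<nu> 1, \<dots>, \<nu> (n - 1)\<close> constitute the past at the moment of that draw.
  The values \<open>\<sigma> 0\<close> and \<open>\<nu> 0\<close> play no role.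
\<close>

definition past ::
  "(nat \<Rightarrow> 'w \<Rightarrow> int ^ 'd::finite) \<Rightarrow> (nat \<Rightarrow> 'w \<Rightarrow> nat) \<Rightarrow> nat \<Rightarrow> 'w \<Rightarrow> (int ^ 'd) list \<times> nat list"
  where "past \<sigma> \<nu> n \<omega> = (map (\<lambda>j. \<sigma> j \<omega>) [1..<Suc n], map (\<lambda>j. \<nu> j \<omega>) [1..<n])"

text \<open>
  The library's two-variable independence requires a common codomain, so independence of \<open>\<nu> n\<close>
  and the past is stated for the \<open>\<sigma>\<close>-algebras they generate.

  All variables involved are discrete, so the conditional law of \<open>\<sigma> (n + 1)\<close> given the past and
  \<open>\<nu> n\<close> is specified on each atom \<open>{\<sigma> j = h j, \<nu> j = m j for 1 \<le> j \<le> n}\<close> of positive probability;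
  there \<open>h (m n)\<close> is the recalled step.
\<close>

locale elephant_walk = prob_space M
  for M :: "'w measure" +
  fixes p :: real
    and \<iota> :: "'d::finite"
    and \<sigma> :: "nat \<Rightarrow> 'w \<Rightarrow> int ^ 'd"
    and \<nu> :: "nat \<Rightarrow> 'w \<Rightarrow> nat"
    and S :: "nat \<Rightarrow> 'w \<Rightarrow> int ^ 'd"
  assumes step_measurable: "\<And>n. n \<ge> 1 \<Longrightarrow> random_variable (count_space UNIV) (\<sigma> n)"
    and pick_measurable: "\<And>n. n \<ge> 1 \<Longrightarrow> random_variable (count_space UNIV) (\<nu> n)"
    and first_step: "\<And>\<omega>. \<omega> \<in> space M \<Longrightarrow> \<sigma> 1 \<omega> = axis \<iota> 1"
    and pick_uniform: "\<And>n. n \<ge> 1 \<Longrightarrow>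
      distr M (count_space UNIV) (\<nu> n) = measure_pmf (pmf_of_set {1..n})"
    and pick_indep: "\<And>n. n \<ge> 1 \<Longrightarrow>
      indep_set (sets (vimage_algebra (space M) (\<nu> n) (count_space UNIV)))
        (sets (vimage_algebra (space M) (past \<sigma> \<nu> n) (count_space UNIV)))"
    and step_law: "\<And>n h m s. n \<ge> 1 \<Longrightarrow> s \<in> unit_steps \<Longrightarrow>
      \<P>(\<omega> in M. \<forall>j\<in>{1..n}. \<sigma> j \<omega> = h j \<and> \<nu> j \<omega> = m j) > 0 \<Longrightarrow>
      \<P>(\<omega> in M. \<sigma> (Suc n) \<omega> = s \<bar> \<forall>j\<in>{1..n}. \<sigma> j \<omega> = h j \<and> \<nu> j \<omega> = m j) =
        (if s = h (m n) then p else (1 - p) / (2 * real CARD('d) - 1))"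
    and walk_0: "\<And>\<omega>. \<omega> \<in> space M \<Longrightarrow> S 0 \<omega> = 0"
    and walk_Suc: "\<And>n \<omega>. \<omega> \<in> space M \<Longrightarrow> S (Suc n) \<omega> = S n \<omega> + \<sigma> (Suc n) \<omega>"

end

theory Submission
  imports Defs
begin

text \<open>
  It suffices to treat \<open>p < 1\<close>: for \<open>p = 1\<close> the walk repeats its first step for ever, so
  \<open>S n = n e\<^sub>1\<close> and every vertex is visited at most once.

  For \<open>p < 1\<close>, recurrence spreads from a vertex to its neighbours. Let \<open>q = (1 - p) / (2 d - 1)\<close>. Given
  the first \<open>n\<close> steps, the next step is \<open>s\<close> with probability \<open>(c p + (n - c) q) / n\<close>, where \<open>c\<close> counts
  the occurrences of \<open>s\<close> among them (\<open>path_prob_snoc\<close>). This is small when \<open>p\<close> is small and most of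
  the past steps equal \<open>s\<close>; but then the walk is far away. Indeed, a walk that stands at \<open>x\<close> has taken
  \<open>s\<close> and \<open>-s\<close> about equally often, up to a constant that depends on \<open>x\<close>, so \<open>c\<close> is at most
  \<open>3 n / 4\<close> once \<open>n\<close> is large, and the step \<open>s\<close> then has probability at least \<open>q / 4\<close>, which is
  positive (\<open>next_prob_lower_bound\<close>).

  Hence, if \<open>x\<close> is visited infinitely often, the walk almost surely leaves \<open>x\<close> infinitely often along
  \<open>s\<close>. This is a conditional Borel-Cantelli statement, and it is proved by a betting argument. A gambler
  who at each visit to \<open>x\<close> after time \<open>N\<close> bets against the step \<open>s\<close> at slightly unfavourable odds owns
  a nonnegative supermartingale (\<open>sum_wealth_le\<close>). If \<open>s\<close> never follows any of infinitely many visits,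
  the wealth tends to infinity, which has probability zero by Markov's inequality
  (\<open>AE_recurrent_vertex_left_along\<close>).

  So, almost surely, the set of vertices that are visited infinitely often is closed under adding unit
  steps, and such a set is empty or the whole lattice (\<open>unit_step_closed_everywhere\<close>).

  Since the first \<open>n\<close> steps take finitely many values almost surely, conditional expectations are
  replaced throughout by finite sums over step lists weighted by their probabilities.
\<close>

section \<open>Unit steps and lists of unit steps\<close>

lemma (in finite_measure) measure_eq_sum_fibres:
  assumes "finite I" "B \<in> sets M" "f \<in> measurable M (count_space UNIV)" "AE \<omega> in M. f \<omega> \<in> I"
  shows "measure M B = (\<Sum>i\<in>I. measure M {\<omega> \<in> B. f \<omega> = i})"
proof -
  have fibre: "{\<omega> \<in> B. f \<omega> = i} \<in> sets M" for i
  proof -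
    have "{\<omega> \<in> B. f \<omega> = i} = B \<inter> (f -` {i} \<inter> space M)"
      using sets.sets_into_space[OF assms(2)] by auto
    then show ?thesis using assms(2,3) by (auto intro: measurable_sets)
  qed
  have "measure M B = measure M (\<Union>i\<in>I. {\<omega> \<in> B. f \<omega> = i})"
    using assms fibre by (intro finite_measure_eq_AE) auto
  also have "\<dots> = (\<Sum>i\<in>I. measure M {\<omega> \<in> B. f \<omega> = i})"
    using assms(1) fibre by (intro finite_measure_finite_Union) (auto simp: disjoint_family_on_def)
  finally show ?thesis .
qed

lemma finite_unit_steps: "finite (unit_steps :: (int ^ 'd::finite) set)"
  by (auto simp: unit_steps_def)

lemma axis_eq_minus_axis: "axis i (1::int) \<noteq> - axis j 1"
proof
  assume "axis i (1::int) = - axis j 1"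
  then have "axis i (1::int) $ i = (- axis j 1) $ i" by simp
  then show False by (auto simp: axis_def split: if_splits)
qed

lemma card_unit_steps: "card (unit_steps :: (int ^ 'd::finite) set) = 2 * CARD('d)"
proof -
  have two: "card {axis i (1::int), - axis i 1} = 2" for i :: 'd
    using axis_eq_minus_axis[of i i] by (metis card_2_iff)
  have "card (unit_steps :: (int ^ 'd::finite) set) = (\<Sum>i::'d\<in>UNIV. card {axis i (1::int), - axis i 1})"
    unfolding unit_steps_def
    by (subst card_UN_disjoint) (auto simp: axis_eq_minus_axis axis_eq_minus_axis[symmetric] axis_eq_axis)
  also have "\<dots> = 2 * CARD('d)"
    by (simp only: two) simp
  finally show ?thesis .
qed

abbreviation step_lists :: "nat \<Rightarrow> (int ^ 'd::finite) list set" where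
  "step_lists n \<equiv> {h. set h \<subseteq> unit_steps \<and> length h = n}"

lemma finite_step_lists: "finite (step_lists n)"
  by (rule finite_lists_length_eq[OF finite_unit_steps])

lemma sum_step_lists_Suc:
  "(\<Sum>h\<in>step_lists (Suc n). f h) = (\<Sum>h\<in>step_lists n. \<Sum>s\<in>unit_steps. f (h @ [s]))"
  for f :: "(int ^ 'd::finite) list \<Rightarrow> real"
proof -
  have "(\<Sum>h\<in>step_lists n. \<Sum>s\<in>unit_steps. f (h @ [s])) =
      (\<Sum>(h, s)\<in>step_lists n \<times> unit_steps. f (h @ [s]))"
    by (simp add: sum.cartesian_product)
  also have "\<dots> = (\<Sum>h\<in>step_lists (Suc n). f h)"
    by (rule sum.reindex_bij_witness[where j = "\<lambda>(h, s). h @ [s]" and i = "\<lambda>h. (butlast h, last h)"])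
       (auto dest: in_set_butlastD simp: subset_iff simp flip: length_0_conv)
  finally show ?thesis ..
qed

section \<open>The law of the sequence of steps\<close>

lemma map_upt_eq_iff:
  "length h = n \<Longrightarrow> map f [1..<Suc n] = h \<longleftrightarrow> (\<forall>j\<in>{1..n}. f j = h ! (j - 1))"
proof (induction h arbitrary: n rule: rev_induct)
  case (snoc a h)
  have "(\<forall>j\<in>{1..length h}. f j = (h @ [a]) ! (j - 1)) \<longleftrightarrow> (\<forall>j\<in>{1..length h}. f j = h ! (j - 1))"
    by (intro ball_cong) (auto simp: nth_append)
  then show ?case
    using snoc by (auto simp: atLeastAtMostSuc_conv)
qed simp

context elephant_walk
begin

definition steps :: "nat \<Rightarrow> 'w \<Rightarrow> (int ^ 'd) list" where
  "steps n \<omega> = map (\<lambda>j. \<sigma> j \<omega>) [1..<Suc n]"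

definition picks :: "nat \<Rightarrow> 'w \<Rightarrow> nat list" where
  "picks n \<omega> = map (\<lambda>j. \<nu> j \<omega>) [1..<Suc n]"

definition path_prob :: "(int ^ 'd) list \<Rightarrow> real" where
  "path_prob h = prob {\<omega> \<in> space M. steps (length h) \<omega> = h}"

text \<open>
  The probability that the walk takes one given step different from the recalled one.
\<close>

definition innovation :: real where
  "innovation = (1 - p) / (2 * real CARD('d) - 1)"

text \<open>
  The conditional probability of the step \<open>s\<close> after the nonempty sequence of steps \<open>h\<close>, averaged over
  the recalled index.
\<close>

definition next_prob :: "(int ^ 'd) list \<Rightarrow> int ^ 'd \<Rightarrow> real" where
  "next_prob h s = (real (count_list h s) * p + (real (length h) - real (count_list h s)) * innovation)
      / real (length h)"

lemma steps_simps [simp]: "steps 0 \<omega> = []" "steps (Suc n) \<omega> = steps n \<omega> @ [\<sigma> (Suc n) \<omega>]"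
  "length (steps n \<omega>) = n"
  by (simp_all add: steps_def)

lemma picks_simps [simp]: "picks 0 \<omega> = []" "picks (Suc n) \<omega> = picks n \<omega> @ [\<nu> (Suc n) \<omega>]"
  "length (picks n \<omega>) = n"
  by (simp_all add: picks_def)

lemma steps_eq_iff: "length h = n \<Longrightarrow> steps n \<omega> = h \<longleftrightarrow> (\<forall>j\<in>{1..n}. \<sigma> j \<omega> = h ! (j - 1))"
  unfolding steps_def by (rule map_upt_eq_iff)

lemma picks_eq_iff: "length h = n \<Longrightarrow> picks n \<omega> = h \<longleftrightarrow> (\<forall>j\<in>{1..n}. \<nu> j \<omega> = h ! (j - 1))"
  unfolding picks_def by (rule map_upt_eq_iff)

lemma steps_measurable: "steps n \<in> measurable M (count_space UNIV)"
proof (induction n)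
  case (Suc n)
  have "(\<lambda>\<omega>. (\<lambda>h \<omega>. h @ [\<sigma> (Suc n) \<omega>]) (steps n \<omega>) \<omega>) \<in> measurable M (count_space UNIV)"
    by (rule measurable_compose_countable[OF _ Suc])
       (rule measurable_compose[OF step_measurable], auto)
  then show ?case by (simp add: steps_def)
qed (simp add: steps_def)

lemma picks_measurable: "picks n \<in> measurable M (count_space UNIV)"
proof (induction n)
  case (Suc n)
  have "(\<lambda>\<omega>. (\<lambda>h \<omega>. h @ [\<nu> (Suc n) \<omega>]) (picks n \<omega>) \<omega>) \<in> measurable M (count_space UNIV)"
    by (rule measurable_compose_countable[OF _ Suc])
       (rule measurable_compose[OF pick_measurable], auto)
  then show ?case by (simp add: picks_def)
qed (simp add: picks_def)

lemma walk_eq_sum_list: "\<omega> \<in> space M \<Longrightarrow> S n \<omega> = sum_list (steps n \<omega>)"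
  by (induction n) (simp_all add: walk_0 walk_Suc)

lemma walk_measurable: "S n \<in> measurable M (count_space UNIV)"
proof -
  have "(\<lambda>\<omega>. sum_list (steps n \<omega>)) \<in> measurable M (count_space UNIV)"
    by (rule measurable_compose[OF steps_measurable]) auto
  then show ?thesis
    by (subst measurable_cong[OF walk_eq_sum_list])
qed

lemma AE_pick_in_range: "n \<ge> 1 \<Longrightarrow> AE \<omega> in M. \<nu> n \<omega> \<in> {1..n}"
proof -
  assume n: "n \<ge> 1"
  have "AE k in distr M (count_space UNIV) (\<nu> n). k \<in> {1..n}"
    unfolding pick_uniform[OF n] using n by (simp add: AE_measure_pmf_iff)
  then show ?thesis
    using pick_measurable[OF n] by (subst (asm) AE_distr_iff) auto
qed

lemma prob_pick: "k \<in> {1..n} \<Longrightarrow> prob {\<omega> \<in> space M. \<nu> n \<omega> = k} = 1 / real n"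
proof -
  assume k: "k \<in> {1..n}"
  then have n: "n \<ge> 1" by auto
  have "prob {\<omega> \<in> space M. \<nu> n \<omega> = k} = measure (distr M (count_space UNIV) (\<nu> n)) {k}"
    using pick_measurable[OF n] by (subst measure_distr) (auto intro!: arg_cong[where f = prob])
  also have "\<dots> = 1 / real n"
    unfolding pick_uniform[OF n] using k n by (simp add: measure_pmf_single)
  finally show ?thesis .
qed

text \<open>
  The recalled index is uniform and independent of the steps seen so far.
\<close>

lemma prob_path_and_pick:
  assumes "k \<in> {1..length h}"
  shows "prob {\<omega> \<in> space M. steps (length h) \<omega> = h \<and> \<nu> (length h) \<omega> = k} = path_prob h / real (length h)"
proof -
  let ?n = "length h"
  have n: "?n \<ge> 1" using assms by auto
  let ?A = "{\<omega> \<in> space M. \<nu> ?n \<omega> = k}" and ?B = "{\<omega> \<in> space M. steps ?n \<omega> = h}"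
  have AB: "?A = \<nu> ?n -` {k} \<inter> space M" "?B = past \<sigma> \<nu> ?n -` {q. fst q = h} \<inter> space M"
    by (auto simp: past_def steps_def)
  have "?A \<in> sets (vimage_algebra (space M) (\<nu> ?n) (count_space UNIV))"
    "?B \<in> sets (vimage_algebra (space M) (past \<sigma> \<nu> ?n) (count_space UNIV))"
    unfolding AB by (rule in_vimage_algebra, simp)+
  from indep_setD[OF pick_indep[OF n] this]
  have "prob (?A \<inter> ?B) = 1 / real ?n * path_prob h"
    by (simp add: prob_pick[OF assms] path_prob_def)
  moreover have "?A \<inter> ?B = {\<omega> \<in> space M. steps ?n \<omega> = h \<and> \<nu> ?n \<omega> = k}" by auto
  ultimately show ?thesis by simp
qed

text \<open>
  The law of the next step is prescribed on atoms that fix all earlier recalled indices as well.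
  As the prescribed value depends only on the last index, summing over the others keeps it.
\<close>

lemma prob_path_pick_step:
  assumes "k \<in> {1..length h}" "s \<in> unit_steps"
  shows "prob {\<omega> \<in> space M. steps (length h) \<omega> = h \<and> \<nu> (length h) \<omega> = k \<and> \<sigma> (Suc (length h)) \<omega> = s} =
    (if s = h ! (k - 1) then p else innovation) *
      prob {\<omega> \<in> space M. steps (length h) \<omega> = h \<and> \<nu> (length h) \<omega> = k}"
    (is "prob ?C = ?w * prob ?B")
proof -
  define n where "n = length h"
  have n: "n \<ge> 1" using assms by (auto simp: n_def)
  have [measurable]: "steps n \<in> measurable M (count_space UNIV)" "\<nu> n \<in> measurable M (count_space UNIV)"
    "\<sigma> (Suc n) \<in> measurable M (count_space UNIV)"
    using steps_measurable pick_measurable step_measurable n by auto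
  let ?I = "{ms. set ms \<subseteq> {1..n} \<and> length ms = n}"
  have I: "finite ?I" by (rule finite_lists_length_eq) simp
  have AE: "AE \<omega> in M. picks n \<omega> \<in> ?I"
  proof -
    have "AE \<omega> in M. \<forall>j\<in>{1..n}. \<nu> j \<omega> \<in> {1..j}"
      by (rule AE_finite_allI[OF finite_atLeastAtMost AE_pick_in_range]) simp
    then show ?thesis
      by eventually_elim (force simp: picks_def)
  qed
  have B: "?B \<in> sets M" and C: "?C \<in> sets M"
    unfolding n_def[symmetric] by measurable
  have fibre: "prob {\<omega> \<in> ?C. picks n \<omega> = ms} = ?w * prob {\<omega> \<in> ?B. picks n \<omega> = ms}"
    if ms: "ms \<in> ?I" for ms
  proof (cases "ms ! (n - 1) = k")
    case False
    then have "\<nu> n \<omega> \<noteq> k" if "picks n \<omega> = ms" for \<omega>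
      using that ms n picks_eq_iff[of ms n \<omega>] by auto
    then have empty: "{\<omega> \<in> ?B. picks n \<omega> = ms} = {}" "{\<omega> \<in> ?C. picks n \<omega> = ms} = {}"
      unfolding n_def[symmetric] by blast+
    show ?thesis unfolding empty by simp
  next
    case True
    define Q where "Q \<omega> \<longleftrightarrow> (\<forall>j\<in>{1..n}. \<sigma> j \<omega> = h ! (j - 1) \<and> \<nu> j \<omega> = ms ! (j - 1))" for \<omega>
    \<comment> \<open>The entry of a list at position \<open>j - 1\<close> belongs to time \<open>j\<close>.\<close>
    have Q: "Q \<omega> \<longleftrightarrow> steps n \<omega> = h \<and> \<nu> n \<omega> = k \<and> picks n \<omega> = ms" for \<omega>
      using ms n True by (auto simp: Q_def n_def[symmetric] picks_eq_iff steps_eq_iff)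
    have eqB: "{\<omega> \<in> ?B. picks n \<omega> = ms} = {\<omega> \<in> space M. Q \<omega>}"
      and eqC: "{\<omega> \<in> ?C. picks n \<omega> = ms} = {\<omega> \<in> space M. \<sigma> (Suc n) \<omega> = s \<and> Q \<omega>}"
      by (auto simp: Q n_def[symmetric])
    have "{\<omega> \<in> space M. Q \<omega>} \<in> sets M"
      using picks_measurable[measurable] unfolding Q by measurable
    show ?thesis
    proof (cases "prob {\<omega> \<in> space M. Q \<omega>} = 0")
      case True
      have "prob {\<omega> \<in> space M. \<sigma> (Suc n) \<omega> = s \<and> Q \<omega>} \<le> prob {\<omega> \<in> space M. Q \<omega>}"
        using \<open>{\<omega> \<in> space M. Q \<omega>} \<in> sets M\<close> by (intro finite_measure_mono) auto
      then have "prob {\<omega> \<in> space M. \<sigma> (Suc n) \<omega> = s \<and> Q \<omega>} = 0"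
        using True measure_nonneg by (metis order_antisym)
      then show ?thesis unfolding eqB eqC using True by simp
    next
      case False
      then have pos: "prob {\<omega> \<in> space M. Q \<omega>} > 0" by (simp add: zero_less_measure_iff)
      have "\<P>(\<omega> in M. \<sigma> (Suc n) \<omega> = s \<bar> Q \<omega>) = (if s = h ! (ms ! (n - 1) - 1) then p else innovation)"
        using step_law[OF n assms(2), of "\<lambda>j. h ! (j - 1)" "\<lambda>j. ms ! (j - 1)"] pos
        unfolding Q_def innovation_def by simp
      then show ?thesis
        unfolding eqB eqC using False True by (simp add: cond_prob_def divide_simps split: if_splits)
    qed
  qed
  have "prob ?C = (\<Sum>ms\<in>?I. prob {\<omega> \<in> ?C. picks n \<omega> = ms})"
    by (rule measure_eq_sum_fibres[OF I C picks_measurable AE])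
  also have "\<dots> = (\<Sum>ms\<in>?I. ?w * prob {\<omega> \<in> ?B. picks n \<omega> = ms})"
    by (rule sum.cong[OF refl fibre])
  also have "\<dots> = ?w * prob ?B"
    unfolding sum_distrib_left[symmetric]
    by (subst measure_eq_sum_fibres[OF I B picks_measurable AE]) (rule refl)
  finally show ?thesis .
qed

text \<open>
  The steps alone obey a product rule, because the transition depends on the recalled
  index only through the step recorded there: among the \<open>n\<close> equally likely indices, those that
  recall \<open>s\<close> contribute \<open>p\<close> and all others contribute the innovation probability.
\<close>

lemma path_prob_snoc:
  assumes "h \<noteq> []" "s \<in> unit_steps"
  shows "path_prob (h @ [s]) = path_prob h * next_prob h s"
proof -
  let ?n = "length h"
  have n: "?n \<ge> 1" using assms by (simp add: Suc_leI)
  let ?C = "{\<omega> \<in> space M. steps ?n \<omega> = h \<and> \<sigma> (Suc ?n) \<omega> = s}"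
  have C: "?C \<in> sets M"
    using steps_measurable[measurable] step_measurable[of "Suc ?n", measurable] by measurable
  have "path_prob (h @ [s]) = prob ?C"
    by (simp add: path_prob_def)
  also have "\<dots> = (\<Sum>k\<in>{1..?n}. prob {\<omega> \<in> ?C. \<nu> ?n \<omega> = k})"
    by (rule measure_eq_sum_fibres[OF _ C pick_measurable[OF n] AE_pick_in_range[OF n]]) simp
  also have "\<dots> = (\<Sum>k\<in>{1..?n}. (if s = h ! (k - 1) then p else innovation) * (path_prob h / ?n))"
  proof (rule sum.cong[OF refl])
    fix k assume k: "k \<in> {1..?n}"
    have "{\<omega> \<in> ?C. \<nu> ?n \<omega> = k} =
        {\<omega> \<in> space M. steps ?n \<omega> = h \<and> \<nu> ?n \<omega> = k \<and> \<sigma> (Suc ?n) \<omega> = s}" by auto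
    then show "prob {\<omega> \<in> ?C. \<nu> ?n \<omega> = k} = (if s = h ! (k - 1) then p else innovation) * (path_prob h / ?n)"
      using prob_path_pick_step[OF k assms(2)] prob_path_and_pick[OF k] by simp
  qed
  also have "\<dots> = (\<Sum>k<?n. if s = h ! k then p else innovation) * (path_prob h / ?n)"
    unfolding sum_distrib_right
    by (rule sum.reindex_bij_witness[where i = Suc and j = "\<lambda>k. k - 1"]) auto
  also have "(\<Sum>k<?n. if s = h ! k then p else innovation) =
      real (count_list h s) * p + (real ?n - real (count_list h s)) * innovation"
    by (induction h rule: rev_induct) (auto simp: nth_append algebra_simps cong: sum.cong_simp)
  finally show ?thesis by (simp add: next_prob_def)
qed

lemma path_prob_first: "path_prob [axis \<iota> 1] = 1"
  using first_step by (simp add: path_prob_def prob_space cong: conj_cong)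

lemma innovation_nonneg: "p \<le> 1 \<Longrightarrow> innovation \<ge> 0"
  unfolding innovation_def by (intro divide_nonneg_nonneg) (use zero_less_card_finite[where 'a='d] in linarith)+

text \<open>
  The counts of the unit steps in \<open>h\<close> add up to its length. Hence the walk almost surely takes no
  step outside the \<open>2 d\<close> unit steps: the prescribed probabilities leave no mass for such a step.
\<close>

lemma sum_next_prob:
  assumes "h \<noteq> []" "set h \<subseteq> unit_steps"
  shows "(\<Sum>s\<in>unit_steps. next_prob h s) = 1"
proof -
  let ?d = "real CARD('d)"
  have "(\<Sum>s\<in>unit_steps. real (count_list h s)) = real (length h)"
    using assms sum_count_set[OF assms(2) finite_unit_steps] by (simp flip: of_nat_sum)
  then have "(\<Sum>s\<in>unit_steps. next_prob h s) =
      (real (length h) * p + (2 * ?d * real (length h) - real (length h)) * innovation) / real (length h)"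
    unfolding next_prob_def sum_divide_distrib[symmetric]
    by (simp add: sum.distrib sum_subtractf card_unit_steps flip: sum_distrib_right)
  also have "\<dots> = p + (2 * ?d - 1) * innovation"
    using assms(1) by (simp add: field_simps)
  also have "\<dots> = 1"
  proof -
    have "2 * ?d - 1 \<noteq> 0" using zero_less_card_finite[where 'a='d] by linarith
    then show ?thesis
      unfolding innovation_def times_divide_eq_right by (subst nonzero_mult_div_cancel_left) simp_all
  qed
  finally show ?thesis .
qed

lemma path_prob_nonneg: "path_prob h \<ge> 0"
  by (simp add: path_prob_def)

lemma path_prob_singleton: "path_prob [s] = (if s = axis \<iota> 1 then 1 else 0)"
proof (cases "s = axis \<iota> 1")
  case False
  then have empty: "{\<omega> \<in> space M. steps (length [s]) \<omega> = [s]} = {}"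
    using first_step by auto
  show ?thesis unfolding path_prob_def empty using False by simp
qed (use path_prob_first in simp)

lemma sum_path_prob: "n \<ge> 1 \<Longrightarrow> (\<Sum>h\<in>step_lists n. path_prob h) = 1"
proof (induction n rule: nat_induct_at_least)
  case base
  have "step_lists 0 = {[] :: (int ^ 'd) list}" by auto
  moreover have "axis \<iota> 1 \<in> unit_steps" by (auto simp: unit_steps_def)
  ultimately show ?case
    by (simp only: One_nat_def sum_step_lists_Suc) (simp add: path_prob_singleton finite_unit_steps)
next
  case (Suc n)
  have "(\<Sum>h\<in>step_lists (Suc n). path_prob h) =
      (\<Sum>h\<in>step_lists n. \<Sum>s\<in>unit_steps. path_prob h * next_prob h s)"
    unfolding sum_step_lists_Suc
    using Suc.hyps by (intro sum.cong refl path_prob_snoc) auto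
  also have "\<dots> = (\<Sum>h\<in>step_lists n. path_prob h)"
    unfolding sum_distrib_left[symmetric]
    using Suc.hyps by (intro sum.cong refl, subst sum_next_prob) auto
  finally show ?case using Suc.IH by simp
qed

lemma prob_steps_in:
  assumes "finite H" "\<And>h. h \<in> H \<Longrightarrow> length h = n"
  shows "prob {\<omega> \<in> space M. steps n \<omega> \<in> H} = (\<Sum>h\<in>H. path_prob h)"
proof -
  note steps_measurable[of n, measurable]
  have "prob {\<omega> \<in> space M. steps n \<omega> \<in> H} = prob (\<Union>h\<in>H. {\<omega> \<in> space M. steps n \<omega> = h})"
    by (rule arg_cong[where f = prob]) auto
  also have "\<dots> = (\<Sum>h\<in>H. prob {\<omega> \<in> space M. steps n \<omega> = h})"
    using assms(1) by (intro finite_measure_finite_Union) (auto simp: disjoint_family_on_def)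
  also have "\<dots> = (\<Sum>h\<in>H. path_prob h)"
    using assms(2) by (intro sum.cong) (auto simp: path_prob_def)
  finally show ?thesis .
qed

lemma AE_unit_steps: "AE \<omega> in M. \<forall>n. set (steps n \<omega>) \<subseteq> unit_steps"
proof (subst AE_all_countable, rule allI)
  fix n
  show "AE \<omega> in M. set (steps n \<omega>) \<subseteq> unit_steps"
  proof (cases "n = 0")
    case False
    have "prob {\<omega> \<in> space M. steps n \<omega> \<in> step_lists n} = 1"
      using False finite_step_lists by (subst prob_steps_in) (auto simp: sum_path_prob)
    from AE_prob_1[OF this] show ?thesis by eventually_elim auto
  qed simp
qed

text \<open>
  With \<open>p = 1\<close> nothing but \<open>e\<^sub>1\<close> can ever be recalled.
\<close>

lemma AE_ballistic:
  assumes "p = 1"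
  shows "AE \<omega> in M. \<forall>n. steps n \<omega> = replicate n (axis \<iota> 1)"
proof (subst AE_all_countable, rule allI)
  fix n
  let ?e = "axis \<iota> 1 :: int ^ 'd"
  have e: "?e \<in> unit_steps" by (auto simp: unit_steps_def)
  have "path_prob (replicate n ?e) = 1" if "n \<ge> 1" for n
    using that
  proof (induction n rule: nat_induct_at_least)
    case base
    then show ?case by (simp add: path_prob_singleton)
  next
    case (Suc n)
    have "count_list (replicate n ?e) ?e = n" by (induction n) auto
    then have "next_prob (replicate n ?e) ?e = 1"
      unfolding next_prob_def using Suc.hyps assms by simp
    then show ?case
      using path_prob_snoc[of "replicate n ?e" ?e] e Suc
      by (simp add: replicate_append_same del: replicate_Suc) (simp add: replicate_append_same)
  qed
  then show "AE \<omega> in M. steps n \<omega> = replicate n ?e"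
  proof (cases "n = 0")
    case False
    then have "prob {\<omega> \<in> space M. steps n \<omega> = replicate n ?e} = 1"
      using \<open>\<And>n. n \<ge> 1 \<Longrightarrow> path_prob (replicate n ?e) = 1\<close>[of n] by (simp add: path_prob_def)
    from AE_prob_1[OF this] show ?thesis by eventually_elim auto
  qed simp
qed

section \<open>A lower bound for the next step at a given vertex\<close>

text \<open>
  The displacement along an axis is the count of \<open>s = \<epsilon> e\<^sub>i\<close> minus the count of \<open>-s\<close>, and these two
  counts together are at most the length.
\<close>

lemma double_count_le:
  assumes "set h \<subseteq> unit_steps" "\<epsilon> = 1 \<or> \<epsilon> = -1"
  shows "2 * int (count_list h (axis i \<epsilon>)) \<le> int (length h) + \<epsilon> * (sum_list h $ i)"
  using assms(1)
proof (induction h)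
  case (Cons t h)
  have "t \<in> unit_steps" using Cons.prems by simp
  then have "(if t = axis i \<epsilon> then 2 else 0) \<le> 1 + \<epsilon> * (t $ i)"
    using assms(2) by (auto simp: unit_steps_def axis_def)
  then show ?case using Cons by (auto simp: algebra_simps split: if_splits)
qed simp

text \<open>
  At a fixed vertex \<open>x\<close>, the previous bound gives \<open>2 c \<le> n + \<bar>x\<^sub>i\<bar>\<close> for the count \<open>c\<close> of \<open>s\<close>, so at
  late times at least a quarter of the recalled indices do not point to \<open>s\<close>. Each of these leads to
  \<open>s\<close> with the innovation probability, whatever \<open>p\<close> is.
\<close>

lemma next_prob_lower_bound:
  assumes "0 \<le> p" "p \<le> 1" "s \<in> unit_steps"
  obtains N where "N \<ge> 1"
    "\<And>h. set h \<subseteq> unit_steps \<Longrightarrow> length h \<ge> N \<Longrightarrow> sum_list h = x \<Longrightarrow> innovation / 4 \<le> next_prob h s"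
proof -
  obtain i and \<epsilon> :: int where s: "s = axis i \<epsilon>" and \<epsilon>: "\<epsilon> = 1 \<or> \<epsilon> = -1"
  proof -
    have "- axis i 1 = axis i (-1 :: int)" for i :: 'd by (simp add: axis_def vec_eq_iff)
    then show ?thesis using assms(3) that by (fastforce simp: unit_steps_def)
  qed
  show ?thesis
    \<comment> \<open>From this length on, \<open>2 c \<le> n + \<bar>x\<^sub>i\<bar>\<close> implies \<open>4 c \<le> 3 n\<close>.\<close>
  proof (rule that[of "nat (2 * \<bar>x $ i\<bar>) + 1"])
    fix h :: "(int ^ 'd) list"
    assume h: "set h \<subseteq> unit_steps" "length h \<ge> nat (2 * \<bar>x $ i\<bar>) + 1" "sum_list h = x"
    let ?c = "real (count_list h s)" and ?n = "real (length h)"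
    have "4 * int (count_list h s) \<le> 3 * int (length h)"
      using double_count_le[OF h(1) \<epsilon>, of i] h(2,3) \<epsilon> unfolding s by auto
    then have c: "?c \<le> 3 / 4 * ?n" by linarith
    have n: "?n > 0" using h(2) by linarith
    have "(?n / 4) * innovation \<le> (?n - ?c) * innovation"
      using c innovation_nonneg[OF assms(2)] by (intro mult_right_mono) auto
    also have "\<dots> \<le> ?c * p + (?n - ?c) * innovation"
      using assms(1) by simp
    finally show "innovation / 4 \<le> next_prob h s"
      using n unfolding next_prob_def by (simp add: field_simps)
  qed simp
qed

end

section \<open>Betting against a step\<close>

text \<open>
  The capital, at the end of the sequence of steps \<open>h\<close>, of a gambler who owns 1 at time \<open>N\<close> and from
  then on stakes everything, at each visit to \<open>x\<close>, on the next step not being \<open>s\<close>. The payoff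
  \<open>1 / (1 - c)\<close> is fair if \<open>s\<close> has conditional probability \<open>c\<close>. Lists count from 0, so \<open>h ! j\<close> is
  the step that follows the position reached at time \<open>j\<close>.
\<close>

definition wealth :: "nat \<Rightarrow> 'a::monoid_add \<Rightarrow> 'a \<Rightarrow> real \<Rightarrow> 'a list \<Rightarrow> real" where
  "wealth N x s c h = (\<Prod>j\<in>{N..<length h}.
     if sum_list (take j h) = x then (if h ! j = s then 0 else 1 / (1 - c)) else 1)"

lemma wealth_snoc:
  "wealth N x s c (h @ [t]) = wealth N x s c h *
     (if N \<le> length h \<and> sum_list h = x then (if t = s then 0 else 1 / (1 - c)) else 1)"
proof -
  have "wealth N x s c h = (\<Prod>j\<in>{N..<length h}.
     if sum_list (take j (h @ [t])) = x then (if (h @ [t]) ! j = s then 0 else 1 / (1 - c)) else 1)"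
    unfolding wealth_def by (intro prod.cong refl) (simp add: nth_append)
  then show ?thesis
    by (auto simp: wealth_def atLeastLessThanSuc)
qed

lemma wealth_nonneg: "c < 1 \<Longrightarrow> wealth N x s c h \<ge> 0"
  unfolding wealth_def by (intro prod_nonneg) auto

context elephant_walk
begin

text \<open>
  The sum is the expected wealth at time \<open>n\<close>. If the step \<open>s\<close> has conditional probability at least
  \<open>c\<close> at every visit, each bet is unfavourable, so the expectation never exceeds the initial capital.
\<close>

lemma sum_wealth_le:
  assumes "N \<ge> 1" "n \<ge> N" "c < 1" "s \<in> unit_steps"
    and bound: "\<And>h. set h \<subseteq> unit_steps \<Longrightarrow> length h \<ge> N \<Longrightarrow> sum_list h = x \<Longrightarrow> c \<le> next_prob h s"
  shows "(\<Sum>h\<in>step_lists n. path_prob h * wealth N x s c h) \<le> 1"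
  using assms(2)
proof (induction n rule: nat_induct_at_least)
  case base
  have "(\<Sum>h\<in>step_lists N. path_prob h * wealth N x s c h) = (\<Sum>h\<in>step_lists N. path_prob h)"
    by (intro sum.cong refl) (auto simp: wealth_def)
  then show ?case using sum_path_prob[OF assms(1)] by simp
next
  case (Suc n)
  have "(\<Sum>t\<in>unit_steps. path_prob (h @ [t]) * wealth N x s c (h @ [t]))
      \<le> path_prob h * wealth N x s c h" if h: "h \<in> step_lists n" for h
  proof -
    let ?f = "\<lambda>t. if sum_list h = x then (if t = s then 0 else 1 / (1 - c)) else 1"
    have ne: "h \<noteq> []" using h Suc.hyps assms(1) by auto
    have total: "(\<Sum>t\<in>unit_steps. next_prob h t) = 1"
      using sum_next_prob[OF ne] h by simp
    have "(\<Sum>t\<in>unit_steps. next_prob h t * ?f t) \<le> 1"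
    proof (cases "sum_list h = x")
      case True
      have "(\<Sum>t\<in>unit_steps. next_prob h t * ?f t) = (\<Sum>t\<in>unit_steps - {s}. next_prob h t / (1 - c))"
        using True finite_unit_steps by (intro sum.mono_neutral_cong_right) auto
      also have "\<dots> = (1 - next_prob h s) / (1 - c)"
        using total assms(4)
        by (simp add: sum_divide_distrib[symmetric] sum_diff1 finite_unit_steps)
      also have "\<dots> \<le> 1"
        using bound[of h] h True Suc.hyps assms(3) by simp
      finally show ?thesis .
    qed (simp add: total)
    moreover have "(\<Sum>t\<in>unit_steps. path_prob (h @ [t]) * wealth N x s c (h @ [t])) =
        (path_prob h * wealth N x s c h) * (\<Sum>t\<in>unit_steps. next_prob h t * ?f t)"
      unfolding sum_distrib_left using h Suc.hyps
      by (intro sum.cong refl) (simp add: path_prob_snoc[OF ne] wealth_snoc)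
    ultimately show ?thesis
      by (simp only:) (intro mult_left_le mult_nonneg_nonneg path_prob_nonneg wealth_nonneg assms(3))
  qed
  then have "(\<Sum>h\<in>step_lists (Suc n). path_prob h * wealth N x s c h)
      \<le> (\<Sum>h\<in>step_lists n. path_prob h * wealth N x s c h)"
    unfolding sum_step_lists_Suc by (rule sum_mono)
  then show ?case using Suc.IH by linarith
qed

lemma prob_wealth_ge:
  assumes "N \<ge> 1" "n \<ge> N" "c < 1" "s \<in> unit_steps" "a > 0"
    and bound: "\<And>h. set h \<subseteq> unit_steps \<Longrightarrow> length h \<ge> N \<Longrightarrow> sum_list h = x \<Longrightarrow> c \<le> next_prob h s"
  shows "prob {\<omega> \<in> space M. set (steps n \<omega>) \<subseteq> unit_steps \<and> wealth N x s c (steps n \<omega>) \<ge> a} \<le> 1 / a"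
proof -
  let ?H = "{h \<in> step_lists n. wealth N x s c h \<ge> a}"
  have "a * prob {\<omega> \<in> space M. steps n \<omega> \<in> ?H} = (\<Sum>h\<in>?H. path_prob h * a)"
    using finite_step_lists[of n]
    by (subst prob_steps_in) (auto simp: sum_distrib_left mult.commute elim: rev_finite_subset)
  also have "\<dots> \<le> (\<Sum>h\<in>?H. path_prob h * wealth N x s c h)"
    using path_prob_nonneg by (intro sum_mono mult_left_mono) auto
  also have "\<dots> \<le> (\<Sum>h\<in>step_lists n. path_prob h * wealth N x s c h)"
    using finite_step_lists[of n]
    by (intro sum_mono2) (auto intro!: mult_nonneg_nonneg path_prob_nonneg wealth_nonneg assms(3))
  also have "\<dots> \<le> 1"
    by (rule sum_wealth_le[OF assms(1-4) bound])
  finally show ?thesis using assms(5) by (simp add: field_simps)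
qed

lemma take_steps: "j \<le> n \<Longrightarrow> take j (steps n \<omega>) = steps j \<omega>"
  by (simp add: steps_def take_map take_upt del: upt_Suc)

lemma nth_steps: "j < n \<Longrightarrow> steps n \<omega> ! j = \<sigma> (Suc j) \<omega>"
  by (simp add: steps_def del: upt_Suc)

text \<open>
  A gambler who never loses is paid once for each visit.
\<close>

lemma wealth_steps:
  assumes "\<omega> \<in> space M" "\<And>j. j \<ge> N \<Longrightarrow> \<not> (S j \<omega> = x \<and> \<sigma> (Suc j) \<omega> = s)"
  shows "wealth N x s c (steps n \<omega>) = (1 / (1 - c)) ^ card {j \<in> {N..<n}. S j \<omega> = x}"
proof -
  have "wealth N x s c (steps n \<omega>) = (\<Prod>j\<in>{N..<n}. if S j \<omega> = x then 1 / (1 - c) else 1)"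
    unfolding wealth_def using assms
    by (intro prod.cong) (auto simp: take_steps nth_steps walk_eq_sum_list)
  also have "\<dots> = (\<Prod>j\<in>{j \<in> {N..<n}. S j \<omega> = x}. 1 / (1 - c))"
    by (rule prod.inter_filter[symmetric]) simp
  finally show ?thesis by simp
qed

lemma visits_io_measurable: "{\<omega> \<in> space M. infinite {n. S n \<omega> = x}} \<in> sets M"
  using walk_measurable[measurable] unfolding infinite_nat_iff_unbounded_le mem_Collect_eq
  by measurable

section \<open>Recurrence spreads to the whole lattice\<close>

text \<open>
  On the event that \<open>x\<close> is visited infinitely often and \<open>s\<close> never follows a visit after time \<open>N\<close>,
  the wealth exceeds \<open>(1 / (1 - c)) ^ K\<close> for every \<open>K\<close>, which by Markov's inequality has probability
  at most \<open>(1 - c) ^ K\<close>.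
\<close>

lemma AE_recurrent_vertex_left_along:
  assumes "N \<ge> 1" "0 < c" "c < 1" "s \<in> unit_steps"
    and bound: "\<And>h. set h \<subseteq> unit_steps \<Longrightarrow> length h \<ge> N \<Longrightarrow> sum_list h = x \<Longrightarrow> c \<le> next_prob h s"
  shows "AE \<omega> in M. infinite {n. S n \<omega> = x} \<longrightarrow> (\<exists>n\<ge>N. S n \<omega> = x \<and> \<sigma> (Suc n) \<omega> = s)"
proof -
  note walk_measurable[measurable] steps_measurable[measurable] visits_io_measurable[measurable]
  have [measurable]: "\<sigma> (Suc n) \<in> measurable M (count_space UNIV)" for n
    by (rule step_measurable) simp
  have [measurable]: "Measurable.pred M (\<lambda>\<omega>. set (steps n \<omega>) \<subseteq> unit_steps)" for n
    by (rule measurable_compose[OF steps_measurable]) simp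
  define E where "E = {\<omega> \<in> space M. infinite {n. S n \<omega> = x} \<and>
    (\<forall>n. set (steps n \<omega>) \<subseteq> unit_steps) \<and> (\<forall>n\<ge>N. \<not> (S n \<omega> = x \<and> \<sigma> (Suc n) \<omega> = s))}"
  have E_sets: "E \<in> sets M" unfolding E_def by measurable
  have "prob E \<le> (1 - c) ^ K" for K
  proof -
    \<comment> \<open>The part of \<open>E\<close> with at least \<open>K\<close> visits before time \<open>n\<close>; it increases to \<open>E\<close>.\<close>
    define D where "D n = {\<omega> \<in> E. card {j \<in> {N..<n}. S j \<omega> = x} \<ge> K}" for n
    have D_eq: "D n = E \<inter> {\<omega> \<in> space M. wealth N x s c (steps n \<omega>) \<ge> (1 / (1 - c)) ^ K}" for n
    proof -
      have iff: "(1 / (1 - c)) ^ K \<le> (1 / (1 - c)) ^ m \<longleftrightarrow> K \<le> m" for m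
        using assms(2,3) by (intro power_increasing_iff) simp
      have "(1 / (1 - c)) ^ K \<le> wealth N x s c (steps n \<omega>) \<longleftrightarrow> K \<le> card {j \<in> {N..<n}. S j \<omega> = x}"
        if "\<omega> \<in> E" for \<omega>
        using that unfolding iff[symmetric] by (subst wealth_steps) (auto simp only: E_def mem_Collect_eq)
      moreover have "E \<subseteq> space M" by (auto simp: E_def)
      ultimately show ?thesis unfolding D_def by blast
    qed
    have D_sets: "D n \<in> sets M" for n
      using E_sets unfolding D_eq by measurable
    have "incseq D"
    proof (rule incseq_SucI, rule subsetI)
      fix n \<omega> assume "\<omega> \<in> D n"
      moreover have "card {j \<in> {N..<n}. S j \<omega> = x} \<le> card {j \<in> {N..<Suc n}. S j \<omega> = x}"
        by (rule card_mono) auto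
      ultimately show "\<omega> \<in> D (Suc n)" by (auto simp: D_def)
    qed
    moreover have "(\<Union>n. D n) = E"
    proof
      show "E \<subseteq> (\<Union>n. D n)"
      proof
        fix \<omega> assume \<omega>: "\<omega> \<in> E"
        have "{n. S n \<omega> = x} \<subseteq> {..<N} \<union> {n. N \<le> n \<and> S n \<omega> = x}" by auto
        then have "infinite {n. N \<le> n \<and> S n \<omega> = x}"
          using \<omega> finite_subset unfolding E_def by blast
        then obtain B where B: "finite B" "card B = K" "B \<subseteq> {n. N \<le> n \<and> S n \<omega> = x}"
          by (metis infinite_arbitrarily_large)
        obtain m where m: "\<And>j. j \<in> B \<Longrightarrow> j < m"
          using B(1) finite_nat_set_iff_bounded by auto
        have "B \<subseteq> {j \<in> {N..<m}. S j \<omega> = x}" using B(3) m by auto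
        then have "K \<le> card {j \<in> {N..<m}. S j \<omega> = x}"
          unfolding B(2)[symmetric] by (rule card_mono[rotated]) simp
        then show "\<omega> \<in> (\<Union>n. D n)" using \<omega> by (auto simp: D_def)
      qed
    qed (auto simp: D_def)
    ultimately have lim: "(\<lambda>n. prob (D n)) \<longlonglongrightarrow> prob E"
      using finite_Lim_measure_incseq[of D] D_sets by auto
    have "prob (D n) \<le> (1 - c) ^ K" if "n \<ge> N" for n
    proof -
      have "prob (D n) \<le> prob {\<omega> \<in> space M. set (steps n \<omega>) \<subseteq> unit_steps \<and>
          wealth N x s c (steps n \<omega>) \<ge> (1 / (1 - c)) ^ K}"
        unfolding D_eq by (rule finite_measure_mono) (auto simp: E_def)
      also have "\<dots> \<le> 1 / (1 / (1 - c)) ^ K"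
        by (rule prob_wealth_ge[OF assms(1) that assms(3,4) _ bound]) (use assms in auto)
      finally show ?thesis using assms(3) by (simp add: power_one_over)
    qed
    then show ?thesis
      using lim by (intro LIMSEQ_le_const2[OF lim]) auto
  qed
  moreover have "(\<lambda>K. (1 - c) ^ K) \<longlonglongrightarrow> 0"
    using assms(2,3) by (intro LIMSEQ_realpow_zero) auto
  ultimately have "prob E \<le> 0"
    by (intro LIMSEQ_le_const) auto
  then have "prob E = 0" by (simp add: measure_le_0_iff)
  then have "AE \<omega> in M. \<omega> \<notin> E"
    using E_sets by (simp add: prob_eq_0)
  with AE_unit_steps AE_space show ?thesis
    by eventually_elim (auto simp: E_def)
qed

text \<open>
  The previous lemma holds for all sufficiently late starting times at once, so the step \<open>s\<close> follows
  infinitely many of the visits to \<open>x\<close>, and each time it leads to \<open>x + s\<close>.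
\<close>

lemma AE_recurrence_spreads:
  assumes "0 \<le> p" "p < 1" "s \<in> unit_steps"
  shows "AE \<omega> in M. infinite {n. S n \<omega> = x} \<longrightarrow> infinite {n. S n \<omega> = x + s}"
proof -
  define c where "c = innovation / 4"
  define D where "D = 2 * real CARD('d) - 1"
  have "D \<ge> 1" unfolding D_def using zero_less_card_finite[where 'a='d] by linarith
  then have "0 < innovation" "innovation \<le> 1 - p"
    using assms unfolding innovation_def D_def[symmetric]
    by (simp_all add: divide_le_eq mult_le_cancel_left1)
  then have c: "0 < c" "c < 1"
    using assms unfolding c_def by auto
  obtain N0 where N0: "N0 \<ge> 1"
    "\<And>h. set h \<subseteq> unit_steps \<Longrightarrow> length h \<ge> N0 \<Longrightarrow> sum_list h = x \<Longrightarrow> c \<le> next_prob h s"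
    using next_prob_lower_bound[of s x] assms unfolding c_def by auto
  have "AE \<omega> in M. infinite {n. S n \<omega> = x} \<longrightarrow> (\<exists>n\<ge>N + N0. S n \<omega> = x \<and> \<sigma> (Suc n) \<omega> = s)" for N
    using N0 by (intro AE_recurrent_vertex_left_along[OF _ c assms(3)]) auto
  then have "AE \<omega> in M. \<forall>N. infinite {n. S n \<omega> = x} \<longrightarrow> (\<exists>n\<ge>N + N0. S n \<omega> = x \<and> \<sigma> (Suc n) \<omega> = s)"
    by (simp only: AE_all_countable) simp
  with AE_space show ?thesis
  proof eventually_elim
    case (elim \<omega>)
    show ?case
    proof
      assume "infinite {n. S n \<omega> = x}"
      then have "\<exists>n\<ge>N. S n \<omega> = x + s" for N
        using elim walk_Suc by (metis add_leD1 le_SucI)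
      then show "infinite {n. S n \<omega> = x + s}"
        unfolding infinite_nat_iff_unbounded_le by simp
    qed
  qed
qed

end

text \<open>
  The translations that preserve \<open>P\<close> form a monoid containing all unit steps. As
  \<open>unit_steps\<close> contains the negative of each of its elements, this monoid is all of the lattice.
\<close>

lemma unit_step_closed_everywhere:
  assumes closed: "\<And>x s. P x \<Longrightarrow> s \<in> unit_steps \<Longrightarrow> P (x + s)" and "P x"
  shows "P (y :: int ^ 'd::finite)"
proof -
  define T where "T = {z. \<forall>x. P x \<longrightarrow> P (x + z)}"
  have T_add: "a + b \<in> T" if "a \<in> T" "b \<in> T" for a b
    using that by (auto simp: T_def simp flip: add.assoc)
  have unit: "axis i 1 \<in> unit_steps" "- axis i 1 \<in> unit_steps" for i :: 'd
    by (auto simp: unit_steps_def)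
  have T_0: "0 \<in> T" by (simp add: T_def)
  have axis_T: "axis i (\<epsilon> * int n) \<in> T" if "\<epsilon> = 1 \<or> \<epsilon> = -1" for i :: 'd and \<epsilon> n
  proof (induction n)
    case (Suc n)
    have "axis i (\<epsilon> * int (Suc n)) = axis i (\<epsilon> * int n) + (if \<epsilon> = 1 then axis i 1 else - axis i 1)"
      using that by (auto simp: vec_eq_iff axis_def)
    moreover have "axis i 1 \<in> T" "- axis i 1 \<in> T"
      unfolding T_def mem_Collect_eq using closed unit by blast+
    ultimately show ?case using Suc T_add by auto
  next
    case 0
    have "axis i 0 = (0 :: int ^ 'd)" by (simp add: vec_eq_iff axis_def)
    then show ?case using T_0 by (metis mult_zero_right of_nat_0)
  qed
  have axis_T': "axis i k \<in> T" for i k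
  proof (cases "k \<ge> 0")
    case True
    then show ?thesis using axis_T[of 1 i "nat k"] by simp
  next
    case False
    then show ?thesis using axis_T[of "-1" i "nat (- k)"] by simp
  qed
  have "(\<Sum>i\<in>I. axis i (z i)) \<in> T" if "finite I" for I :: "'d set" and z
    using that by induction (auto intro: T_0 T_add axis_T')
  moreover have "(\<Sum>i\<in>UNIV. axis i ((y - x) $ i)) = y - x"
    by (simp add: vec_eq_iff axis_def)
  ultimately have "y - x \<in> T" by (metis finite)
  then have "P (x + (y - x))" using \<open>P x\<close> unfolding T_def by blast
  then show ?thesis by simp
qed

theorem proposition1p14:
  fixes M :: "'w measure"
    and p :: real
    and \<iota> :: "'d::finite"
    and \<sigma> :: "nat \<Rightarrow> 'w \<Rightarrow> int ^ 'd"
    and \<nu> :: "nat \<Rightarrow> 'w \<Rightarrow> nat"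
    and S :: "nat \<Rightarrow> 'w \<Rightarrow> int ^ 'd"
  assumes "0 \<le> p" and "p \<le> 1"
    and "elephant_walk M p \<iota> \<sigma> \<nu> S"
  defines "A1 \<equiv> {\<omega> \<in> space M. \<forall>x. infinite {n. S n \<omega> = x}}"
    and "A2 \<equiv> {\<omega> \<in> space M. \<forall>x. finite {n. S n \<omega> = x}}"
  shows "measure M (A1 \<union> A2) = 1"
proof -
  interpret elephant_walk M p \<iota> \<sigma> \<nu> S by fact
  note visits_io_measurable[measurable]
  have "{\<omega> \<in> space M. finite {n. S n \<omega> = x}} \<in> sets M" for x
  proof -
    have "{\<omega> \<in> space M. \<not> infinite {n. S n \<omega> = x}} \<in> sets M" by measurable
    then show ?thesis by simp
  qed
  note this[measurable]
  have sets: "A1 \<union> A2 \<in> sets M"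
    unfolding A1_def A2_def by measurable
  have "AE \<omega> in M. \<omega> \<in> A1 \<union> A2"
  proof (cases "p = 1")
    case True
    from AE_ballistic[OF True] AE_space show ?thesis
    proof eventually_elim
      case (elim \<omega>)
      have "sum_list (replicate n (axis \<iota> 1)) $ \<iota> = int n" for n
        by (induction n) simp_all
      then have "S n \<omega> $ \<iota> = int n" for n
        using elim walk_eq_sum_list[of \<omega> n] by simp
      then have "{n. S n \<omega> = x} \<subseteq> {nat (x $ \<iota>)}" for x
        by force
      then have "finite {n. S n \<omega> = x}" for x
        using finite_subset by blast
      then show ?case using elim by (simp add: A2_def)
    qed
  next
    case False
    then have "p < 1" using assms(2) by simp
    have "AE \<omega> in M. \<forall>s\<in>unit_steps. infinite {n. S n \<omega> = x} \<longrightarrow> infinite {n. S n \<omega> = x + s}" for x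
      by (rule AE_finite_allI[OF finite_unit_steps AE_recurrence_spreads[OF assms(1) \<open>p < 1\<close>]])
    then have "AE \<omega> in M. \<forall>x. \<forall>s\<in>unit_steps.
        infinite {n. S n \<omega> = x} \<longrightarrow> infinite {n. S n \<omega> = x + s}"
      by (subst AE_all_countable) (rule allI)
    with AE_space show ?thesis
    proof eventually_elim
      case (elim \<omega>)
      have "infinite {n. S n \<omega> = y}" if "infinite {n. S n \<omega> = x}" for x y
        using unit_step_closed_everywhere[of "\<lambda>x. infinite {n. S n \<omega> = x}" x y] elim that by blast
      then show ?case using elim by (auto simp: A1_def A2_def)
    qed
  qed
  then show ?thesis using sets by (simp add: prob_eq_1)
qed

end
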